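(* Let $G$ be any finite solvable group. Then the derived length of $G$ is at most $2+\frac{5}{2}\log_3(\lambda(G))$, where $\lambda(G)$ denotes the number of maximal cyclic subgroups of $G$.
   Context: A subgroup $H$ of a finite group $G$ is called a maximal cyclic subgroup if it is cyclic and not properly contained in any cyclic subgroup of $G$. $\lambda(G)$ denotes the number of maximal cyclic subgroups of $G$ (so $\lambda(G)=1$ if and only if $G$ is cyclic). *)

theory Defs
  imports Complex_Main "HOL-Algebra.Algebra"
begin

definition cyclic_subgroup :: "'a set \<Rightarrow> ('a, 'b) monoid_scheme \<Rightarrow> bool" where
  "cyclic_subgroup H G \<longleftrightarrow> subgroup H G \<and> cyclic_group (G\<lparr>carrier := H\<rparr>)"

definition maximal_cyclic_subgroup :: "'a set \<Rightarrow> ('a, 'b) monoid_scheme \<Rightarrow> bool" where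
  "maximal_cyclic_subgroup H G \<longleftrightarrow>
     cyclic_subgroup H G \<and> \<not> (\<exists>K. cyclic_subgroup K G \<and> H \<subset> K)"

definition num_maximal_cyclic :: "('a, 'b) monoid_scheme \<Rightarrow> nat" where
  "num_maximal_cyclic G = card {H. maximal_cyclic_subgroup H G}"

(* Only meaningful for solvable G, where some term of the derived series is trivial
   (group.solvable_iff_trivial_derived_seq). *)
definition derived_length :: "('a, 'b) monoid_scheme \<Rightarrow> nat" where
  "derived_length G = (LEAST n. (derived G ^^ n) (carrier G) = {\<one>\<^bsub>G\<^esub>})"

end

(* The group G is the union of lambda(G) cyclic subgroups, so one of them has index at most
   lambda(G). By the Chermak-Delgado argument (maximize |H| |C_G(H)| over the subgroups H), G has an
   abelian normal subgroup M of index at most lambda(G)^2. In the derived series of G/M, two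
   consecutive nontrivial steps have joint index at least 6, because their quotient is nonabelian and
   the index is composite. As 6^5 >= 81^2, the derived length n of G/M satisfies
   81^n <= 81 |G/M|^5 <= 81 lambda(G)^10, and G has derived length at most n + 1. *)

theory Submission
  imports Defs
begin

context group
begin

section \<open>Orders of product sets and the Chermak-Delgado measure\<close>

text \<open>Multiplication sends \<open>H \<times> K\<close> into \<open>S\<close>, and no fibre has
  more than |\<open>H \<inter> K\<close>| elements. \<open>S\<close> is any superset of the product:
  in one application it is a generated subgroup, in the other a centralizer.\<close>

lemma card_prod_le_card_Int_mult:
  assumes "finite (carrier G)" "subgroup H G" "subgroup K G" "H <#> K \<subseteq> S" "S \<subseteq> carrier G"
  shows "card H * card K \<le> card (H \<inter> K) * card S"
proof -
  interpret H: subgroup H G by fact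
  interpret K: subgroup K G by fact
  have fin: "finite H" "finite K" "finite S"
    using assms(1,5) H.subset K.subset by (auto intro: finite_subset)
  let ?f = "\<lambda>(h, k). h \<otimes> k"
  \<comment> \<open>If h'k' = hk, then inv h h' = k inv k' lies in both subgroups, and this element
    determines the pair (h', k').\<close>
  have fibre: "card {p \<in> H \<times> K. ?f p = ?f (h, k)} \<le> card (H \<inter> K)" if hk: "h \<in> H" "k \<in> K" for h k
  proof (rule card_inj_on_le)
    show "inj_on (\<lambda>(h', k'). inv h \<otimes> h') {p \<in> H \<times> K. ?f p = ?f (h, k)}"
    proof (rule inj_onI, clarify, rule conjI)
      fix h1 k1 h2 k2
      assume a: "h1 \<in> H" "k1 \<in> K" "h2 \<in> H" "k2 \<in> K" "h1 \<otimes> k1 = h \<otimes> k" "h2 \<otimes> k2 = h \<otimes> k"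
        "inv h \<otimes> h1 = inv h \<otimes> h2"
      show eq: "h1 = h2"
        using a hk by (simp add: H.mem_carrier)
      show "k1 = k2"
        using a eq H.mem_carrier K.mem_carrier by (metis l_cancel)
    qed
    show "(\<lambda>(h', k'). inv h \<otimes> h') ` {p \<in> H \<times> K. ?f p = ?f (h, k)} \<subseteq> H \<inter> K"
    proof clarify
      fix h1 k1 assume a: "h1 \<in> H" "k1 \<in> K" "h1 \<otimes> k1 = h \<otimes> k"
      have "inv h \<otimes> h1 = k \<otimes> inv k1"
        using a hk H.mem_carrier K.mem_carrier by (metis inv_closed inv_solve_left inv_solve_right m_assoc m_closed)
      moreover have "inv h \<otimes> h1 \<in> H" "k \<otimes> inv k1 \<in> K" using a hk by auto
      ultimately show "inv h \<otimes> h1 \<in> H \<inter> K" by auto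
    qed
  qed (use fin in auto)
  have img: "?f ` (H \<times> K) \<subseteq> S" using assms(4) by (auto simp: set_mult_def)
  have "card H * card K = (\<Sum>p\<in>H \<times> K. 1)" by (simp add: card_cartesian_product)
  also have "\<dots> = (\<Sum>y\<in>?f ` (H \<times> K). card {p \<in> H \<times> K. ?f p = y})"
    using sum.image_gen[of "H \<times> K" "\<lambda>_. 1::nat" ?f] fin by simp
  also have "\<dots> \<le> (\<Sum>y\<in>?f ` (H \<times> K). card (H \<inter> K))"
    by (rule sum_mono) (use fibre in auto)
  also have "\<dots> = card (?f ` (H \<times> K)) * card (H \<inter> K)" by simp
  also have "\<dots> \<le> card S * card (H \<inter> K)"
    by (intro mult_right_mono card_mono img fin) auto
  finally show ?thesis by (simp add: mult.commute)
qed

definition centralizer :: "'a set \<Rightarrow> 'a set" where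
  "centralizer H = {x \<in> carrier G. \<forall>h\<in>H. x \<otimes> h = h \<otimes> x}"

lemma centralizer_subgroup:
  assumes "H \<subseteq> carrier G"
  shows "subgroup (centralizer H) G"
proof (rule subgroupI)
  show "centralizer H \<noteq> {}" using assms by (auto simp: centralizer_def intro!: exI[of _ \<one>])
  fix x assume x: "x \<in> centralizer H"
  have "inv x \<otimes> h = h \<otimes> inv x" if "h \<in> H" for h
  proof -
    have c: "x \<in> carrier G" "h \<in> carrier G" "x \<otimes> h = h \<otimes> x"
      using that x assms by (auto simp: centralizer_def)
    then have "h = x \<otimes> (h \<otimes> inv x)" by (simp flip: m_assoc) (simp add: m_assoc)
    with c show ?thesis using inv_solve_left[of "h \<otimes> inv x" x h] by simp
  qed
  then show "inv x \<in> centralizer H" using x by (simp add: centralizer_def)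
  fix y assume y: "y \<in> centralizer H"
  have "x \<otimes> y \<otimes> h = h \<otimes> (x \<otimes> y)" if "h \<in> H" for h
  proof -
    have c: "x \<in> carrier G" "y \<in> carrier G" "h \<in> carrier G" "x \<otimes> h = h \<otimes> x" "y \<otimes> h = h \<otimes> y"
      using that x y assms by (auto simp: centralizer_def)
    then have "x \<otimes> y \<otimes> h = x \<otimes> h \<otimes> y" by (metis m_assoc)
    also have "\<dots> = h \<otimes> x \<otimes> y" using c by simp
    finally show ?thesis using c by (simp add: m_assoc)
  qed
  then show "x \<otimes> y \<in> centralizer H" using x y by (simp add: centralizer_def)
qed (auto simp: centralizer_def)

text \<open>This is the Chermak-Delgado measure of \<open>H\<close>.\<close>

definition cd_measure :: "'a set \<Rightarrow> nat" where
  "cd_measure H = card H * card (centralizer H)"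

text \<open>Let L be generated by H and K. The product bound is applied to H and K inside L, and to
  their centralizers inside the centralizer of \<open>H \<inter> K\<close>; the centralizers of H
  and K meet inside that of L. Multiplying the two bounds gives the claim. Its use: if H and K have
  maximal measure, so has \<open>H \<inter> K\<close>.\<close>

lemma cd_measure_Int:
  assumes fin: "finite (carrier G)" and H: "subgroup H G" and K: "subgroup K G"
  obtains L where "subgroup L G" "cd_measure H * cd_measure K \<le> cd_measure (H \<inter> K) * cd_measure L"
proof -
  have HK: "H \<subseteq> carrier G" "K \<subseteq> carrier G" using H K subgroup.subset by auto
  define L where "L = generate G (H \<union> K)"
  have L: "subgroup L G" unfolding L_def using HK by (intro generate_is_subgroup) auto
  have 1: "card H * card K \<le> card (H \<inter> K) * card L"
  proof (rule card_prod_le_card_Int_mult[OF fin H K])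
    show "H <#> K \<subseteq> L"
      unfolding L_def set_mult_def by (auto intro: generate.eng generate.incl)
  qed (use L subgroup.subset in auto)
  have cL: "centralizer H \<inter> centralizer K \<subseteq> centralizer L"
  proof
    fix x assume x: "x \<in> centralizer H \<inter> centralizer K"
    \<comment> \<open>The roles are exchanged: the centralizer of x is a subgroup, so it contains L
      once it contains the generators.\<close>
    have "H \<union> K \<subseteq> centralizer {x}"
      using x HK by (auto simp: centralizer_def)
    then have "L \<subseteq> centralizer {x}"
      unfolding L_def using x by (intro generate_subgroup_incl centralizer_subgroup) (auto simp: centralizer_def)
    then show "x \<in> centralizer L" using x by (auto simp: centralizer_def)
  qed
  have finL: "finite (centralizer L)" by (rule finite_subset[OF _ fin]) (auto simp: centralizer_def)
  have "card (centralizer H) * card (centralizer K)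
      \<le> card (centralizer H \<inter> centralizer K) * card (centralizer (H \<inter> K))"
  proof (rule card_prod_le_card_Int_mult[OF fin centralizer_subgroup centralizer_subgroup])
    have sg: "subgroup (centralizer (H \<inter> K)) G" using HK by (intro centralizer_subgroup) auto
    show "centralizer H <#> centralizer K \<subseteq> centralizer (H \<inter> K)"
      using subgroup.m_closed[OF sg] by (auto simp: set_mult_def) (auto simp: centralizer_def)
  qed (use HK in \<open>auto simp: centralizer_def\<close>)
  also have "\<dots> \<le> card (centralizer L) * card (centralizer (H \<inter> K))"
    by (intro mult_right_mono card_mono finL cL) auto
  finally have 2: "card (centralizer H) * card (centralizer K)
      \<le> card (centralizer L) * card (centralizer (H \<inter> K))" .
  have "cd_measure H * cd_measure K \<le> cd_measure (H \<inter> K) * cd_measure L"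
    using mult_mono[OF 1 2] by (simp add: cd_measure_def algebra_simps)
  with L show ?thesis by (rule that)
qed

text \<open>The least subgroup of maximal measure: it is contained in its conjugates and in its
  centralizer, since those have maximal measure as well.\<close>

lemma exists_large_abelian_normal_subgroup:
  assumes fin: "finite (carrier G)"
    and A: "subgroup A G" "comm_group (G\<lparr>carrier := A\<rparr>)"
  obtains M where "M \<lhd> G" "comm_group (G\<lparr>carrier := M\<rparr>)" "card A ^ 2 \<le> card M * card (carrier G)"
proof -
  let ?S = "{H. subgroup H G}"
  have finS: "finite ?S"
    by (rule finite_subset[of _ "Pow (carrier G)"]) (use fin subgroup.subset in auto)
  define m where "m = Max (cd_measure ` ?S)"
  have le_m: "cd_measure H \<le> m" if "subgroup H G" for H
    unfolding m_def using finS that by (intro Max_ge) auto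
  have "m \<in> cd_measure ` ?S"
    unfolding m_def using finS subgroup_self by (intro Max_in) auto
  then obtain H0 where H0: "subgroup H0 G \<and> cd_measure H0 = m" by auto
  define M where "M = (ARG_MIN card H. subgroup H G \<and> cd_measure H = m)"
  have M: "subgroup M G" "cd_measure M = m"
    and M_min: "\<And>H. subgroup H G \<Longrightarrow> cd_measure H = m \<Longrightarrow> card M \<le> card H"
    using arg_min_nat_lemma[of "\<lambda>H. subgroup H G \<and> cd_measure H = m", OF H0, of card]
    unfolding M_def by auto
  interpret M: subgroup M G by fact
  have m_pos: "m > 0"
  proof -
    have "cd_measure {\<one>} > 0"
      unfolding cd_measure_def using fin by (auto simp: centralizer_def card_gt_0_iff intro: exI[of _ \<one>])
    with le_m[OF triv_subgroup] show ?thesis by simp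
  qed
  have finM: "finite M" using finite_subset[OF M.subset fin] .
  \<comment> \<open>From m * m \<le> \<open>cd_measure (M \<inter> K)\<close> * m the intersection
    again has maximal measure, so the minimality of |M| forces \<open>M \<inter> K = M\<close>.
    Cancelling m is possible by \<open>m_pos\<close>.\<close>
  have M_sub: "M \<subseteq> K" if K: "subgroup K G" "cd_measure K \<ge> m" for K
  proof -
    obtain L where L: "subgroup L G" "cd_measure M * cd_measure K \<le> cd_measure (M \<inter> K) * cd_measure L"
      using cd_measure_Int[OF fin M(1) K(1)] .
    have "m * m \<le> cd_measure M * cd_measure K" using K M by auto
    also have "\<dots> \<le> cd_measure (M \<inter> K) * m"
      using L le_m[OF L(1)] by (meson le_trans mult_le_mono2)
    finally have "m \<le> cd_measure (M \<inter> K)" using m_pos by simp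
    moreover have sg: "subgroup (M \<inter> K) G" using M K by (simp add: subgroups_Inter_pair)
    ultimately have "card M \<le> card (M \<inter> K)" using le_m M_min by (metis le_antisym)
    then have "M \<inter> K = M" by (intro card_seteq finM) auto
    then show ?thesis by auto
  qed
  \<comment> \<open>M lies in its double centralizer, so passing from M to
    \<open>centralizer M\<close> does not decrease the measure.\<close>
  have "M \<subseteq> centralizer M"
  proof (rule M_sub[OF centralizer_subgroup[OF M.subset]])
    have "card M \<le> card (centralizer (centralizer M))"
      using M.subset by (intro card_mono finite_subset[OF _ fin]) (auto simp: centralizer_def)
    then show "m \<le> cd_measure (centralizer M)"
      using M(2) unfolding cd_measure_def by (metis mult.commute mult_le_mono2)
  qed
  then have "comm_group (G\<lparr>carrier := M\<rparr>)"
    by (intro group.group_comm_groupI subgroup_imp_group M(1)) (auto simp: centralizer_def)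
  moreover have "M \<lhd> G"
  proof (rule normal_invI[OF M(1)])
    fix g h assume g: "g \<in> carrier G" and h: "h \<in> M"
    \<comment> \<open>Conjugation by inv g is used, so that h = \<open>?c x\<close> with x in M
      turns into g h inv g = x.\<close>
    let ?c = "\<lambda>x. inv g \<otimes> x \<otimes> g"
    have cancel: "g \<otimes> (inv g \<otimes> z) = z" if "z \<in> carrier G" for z
      using that g by (simp flip: m_assoc)
    have inj: "inj_on ?c (carrier G)" using g by (intro inj_onI) simp
    have hom: "?c (x \<otimes> y) = ?c x \<otimes> ?c y" if "x \<in> carrier G" "y \<in> carrier G" for x y
      using that g by (simp add: m_assoc cancel)
    have sg: "subgroup (?c ` M) G"
    proof -
      have "group_hom G G ?c"
        using g hom by (unfold_locales) (auto simp: hom_def)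
      then show ?thesis using M(1) by (rule group_hom.subgroup_img_is_subgroup)
    qed
    \<comment> \<open>This inclusion already shows that the conjugate has measure at least m, as
      \<open>M_sub\<close> requires.\<close>
    have "?c ` centralizer M \<subseteq> centralizer (?c ` M)"
    proof clarify
      fix x assume x: "x \<in> centralizer M"
      have "?c x \<otimes> ?c y = ?c y \<otimes> ?c x" if "y \<in> M" for y
        using that x by (simp add: centralizer_def hom[symmetric] M.mem_carrier)
      then show "?c x \<in> centralizer (?c ` M)"
        using x g by (auto simp: centralizer_def)
    qed
    then have "card (?c ` centralizer M) \<le> card (centralizer (?c ` M))"
      by (intro card_mono finite_subset[OF _ fin]) (auto simp: centralizer_def)
    moreover have "card (?c ` centralizer M) = card (centralizer M)"
      by (intro card_image inj_on_subset[OF inj]) (auto simp: centralizer_def)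
    moreover have "card (?c ` M) = card M"
      by (intro card_image inj_on_subset[OF inj] M.subset)
    ultimately have "m \<le> cd_measure (?c ` M)"
      using M(2) by (auto simp: cd_measure_def)
    from M_sub[OF sg this] h obtain x where x: "x \<in> M" "h = ?c x" by auto
    then have "g \<otimes> h \<otimes> inv g = x" using g M.mem_carrier[OF x(1)]
      by (simp add: m_assoc cancel)
    with x show "g \<otimes> h \<otimes> inv g \<in> M" by simp
  qed
  moreover have "card A ^ 2 \<le> card M * card (carrier G)"
  proof -
    interpret A: comm_group "G\<lparr>carrier := A\<rparr>" by fact
    have cc: "centralizer H \<subseteq> carrier G" for H by (auto simp: centralizer_def)
    \<comment> \<open>An abelian A has measure at least |A|^2, which the maximal measure |M| |C(M)|
      \<le> |M| |G| must dominate.\<close>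
    have "A \<subseteq> centralizer A" using A.m_comm subgroup.subset[OF A(1)] by (auto simp: centralizer_def)
    then have "card A ^ 2 \<le> cd_measure A"
      unfolding cd_measure_def power2_eq_square
      by (intro mult_le_mono2 card_mono finite_subset[OF cc fin])
    also have "\<dots> \<le> cd_measure M" using le_m[OF A(1)] M by simp
    also have "\<dots> \<le> card M * card (carrier G)"
      unfolding cd_measure_def by (intro mult_le_mono2 card_mono fin cc)
    finally show ?thesis .
  qed
  ultimately show ?thesis by (intro that)
qed

section \<open>Indices in the derived series\<close>

text \<open>The elements 1, x, y, xy and yx are pairwise distinct.\<close>

lemma order_ge_5_if_noncommuting:
  assumes "finite (carrier G)" "x \<in> carrier G" "y \<in> carrier G" "x \<otimes> y \<noteq> y \<otimes> x"
  shows "5 \<le> card (carrier G)"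
proof -
  have "x \<noteq> \<one>" "y \<noteq> \<one>" "x \<noteq> y" using assms by auto
  moreover from this have "x \<otimes> y \<noteq> x" "x \<otimes> y \<noteq> y" "y \<otimes> x \<noteq> x" "y \<otimes> x \<noteq> y"
    using assms by auto
  moreover have "x \<otimes> y \<noteq> \<one>" "y \<otimes> x \<noteq> \<one>"
    using assms inv_comm by metis+
  ultimately have "distinct [\<one>, x, y, x \<otimes> y, y \<otimes> x]" using assms(4) by auto
  then have "card {\<one>, x, y, x \<otimes> y, y \<otimes> x} = 5"
    using distinct_card by fastforce
  moreover have "card {\<one>, x, y, x \<otimes> y, y \<otimes> x} \<le> card (carrier G)"
    using assms by (intro card_mono) auto
  ultimately show ?thesis by simp
qed

lemma card_psubgroup:
  assumes "finite (carrier G)" "subgroup H G" "subgroup N G" "N \<subset> H"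
  obtains k where "2 \<le> k" "card H = k * card N"
proof -
  have "subgroup N (G\<lparr>carrier := H\<rparr>)" using assms by (intro subgroup_incl) auto
  from group.lagrange[OF subgroup_imp_group[OF assms(2)] this]
  have "card N dvd card H" unfolding order_def by (simp add: dvd_def) (metis mult.commute)
  then obtain k where k: "card H = k * card N" by (metis dvd_div_mult_self)
  have "card N < card H"
    using assms by (intro psubset_card_mono finite_subset[OF _ assms(1)] subgroup.subset) auto
  then have "2 \<le> k" using k by (cases "k = 0 \<or> k = 1") auto
  from this k show ?thesis by (rule that)
qed

text \<open>The quotient by the second derived subgroup is nonabelian, since otherwise the first
  derived subgroup would lie in the second; so its order is at least 5. That order is also a product
  of two indices that are at least 2, which excludes 5.\<close>

lemma card_second_derived_carrier:
  assumes fin: "finite (carrier G)"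
    and neq: "derived G (derived G (carrier G)) \<noteq> derived G (carrier G)"
  shows "6 * card (derived G (derived G (carrier G))) \<le> card (carrier G)"
proof -
  let ?D = "derived G (carrier G)" and ?E = "derived G (derived G (carrier G))"
  have D: "subgroup ?D G" by (simp add: derived_is_subgroup)
  have E: "?E \<lhd> G" by (intro derived_is_normal derived_self_is_normal)
  have ED: "?E \<subset> ?D" using neq derived_incl[OF _ D] by blast
  have DG: "?D \<subset> carrier G" using neq subgroup.subset[OF D] by auto
  obtain a where a: "2 \<le> a" "card ?D = a * card ?E"
    using card_psubgroup[OF fin D normal_imp_subgroup[OF E] ED] .
  obtain b where b: "2 \<le> b" "card (carrier G) = b * card ?D"
    using card_psubgroup[OF fin subgroup_self D DG] .
  interpret Q: group "G Mod ?E" using E by (rule normal.factorgroup_is_group)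
  have "card (rcosets ?E) * card ?E = card (carrier G)"
    using lagrange[OF normal_imp_subgroup[OF E]] by (simp add: order_def)
  moreover have E0: "card ?E > 0"
    using finite_subset[OF subgroup.subset[OF normal_imp_subgroup[OF E]] fin]
      subgroup.one_closed[OF normal_imp_subgroup[OF E]] by (auto simp: card_gt_0_iff)
  ultimately have ab: "card (carrier (G Mod ?E)) = a * b"
    using a(2) b(2) by (simp add: FactGroup_def)
  have "\<not> comm_group (G Mod ?E)" using derived_minimal[OF E] ED by auto
  then obtain x y where "x \<in> carrier (G Mod ?E)" "y \<in> carrier (G Mod ?E)"
    "x \<otimes>\<^bsub>G Mod ?E\<^esub> y \<noteq> y \<otimes>\<^bsub>G Mod ?E\<^esub> x"
    using Q.group_comm_groupI by blast
  moreover have "finite (carrier (G Mod ?E))"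
    using ab a b by (intro card_ge_0_finite) auto
  ultimately have "5 \<le> a * b" using Q.order_ge_5_if_noncommuting ab by metis
  have "6 \<le> a * b"
  \<comment> \<open>For \<open>a = 2\<close> the product is even, hence not 5; otherwise
    \<open>a\<close> is at least 3 and \<open>b\<close> at least 2.\<close>
  proof (cases "a = 2")
    case False
    then have "3 * 2 \<le> a * b" using a(1) b(1) by (intro mult_le_mono) auto
    then show ?thesis by simp
  qed (use \<open>5 \<le> a * b\<close> in presburger)
  then have "6 * card ?E \<le> a * b * card ?E" by simp
  then show ?thesis using a(2) b(2) by (simp add: mult.assoc mult.left_commute)
qed

text \<open>Derived subgroups do not depend on the ambient group, so the bound passes to every term
  of the derived series.\<close>

lemma card_second_derived:
  assumes "finite (carrier G)" and H: "subgroup H G"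
    and "derived G (derived G H) \<noteq> derived G H"
  shows "6 * card (derived G (derived G H)) \<le> card H"
proof -
  let ?H = "G\<lparr>carrier := H\<rparr>"
  have "finite (carrier ?H)" using finite_subset[OF subgroup.subset[OF H] assms(1)] by simp
  moreover have "derived ?H (carrier ?H) = derived G H"
    using derived_consistent[OF _ H] by simp
  moreover have "derived ?H (derived G H) = derived G (derived G H)"
    using derived_consistent[OF derived_incl[OF _ H] H] by simp
  ultimately show ?thesis
    using group.card_second_derived_carrier[OF subgroup_imp_group[OF H]] assms(3) by simp
qed

text \<open>Induction in steps of two: adding two terms multiplies the left side by 81^2 = 6561 and
  the right side by at least 6^5 = 7776. The extra factor 81 pays for the single step that can
  remain.\<close>

lemma card_ge_of_derived_series:
  assumes fin: "finite (carrier G)" and "subgroup H G"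
    and "(derived G ^^ n) H = {\<one>}" "\<And>k. k < n \<Longrightarrow> (derived G ^^ k) H \<noteq> {\<one>}"
  shows "81 ^ n \<le> 81 * card H ^ 5"
  using assms(2-)
proof (induction n arbitrary: H rule: less_induct)
  case (less n)
  have finH: "finite H" using finite_subset[OF subgroup.subset[OF less.prems(1)] fin] .
  then have pos: "card H > 0"
    using subgroup.one_closed[OF less.prems(1)] by (auto simp: card_gt_0_iff)
  show ?case
  proof (cases "n \<le> 1")
    case True
    then have "(81::nat) ^ n \<le> 81 ^ 1" by (intro power_increasing) auto
    then show ?thesis using pos by (simp add: order_trans[of _ 81])
  next
    case False
    define k where "k = n - 2"
    with False have n: "n = Suc (Suc k)" by simp
    let ?D = "derived G H" and ?E = "derived G (derived G H)"
    \<comment> \<open>Otherwise the series would be constant from index 1 on, hence trivial there,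
      although 1 < n.\<close>
    have neq: "?E \<noteq> ?D"
    proof
      assume "?E = ?D"
      then have "(derived G ^^ Suc i) H = ?D" for i by (induction i) auto
      then show False using less.prems(2) less.prems(3)[of 1] n by (metis One_nat_def Suc_less_eq funpow_0 funpow_simps_right(2) comp_apply zero_less_Suc)
    qed
    have sE: "subgroup ?E G"
      using less.prems(1) exp_of_derived_is_subgroup[of H 2] by (simp add: numeral_2_eq_2)
    have "81 ^ k \<le> 81 * card ?E ^ 5"
    proof (rule less.IH[OF _ sE])
      show "(derived G ^^ k) ?E = {\<one>}" using less.prems(2) n by (simp add: funpow_swap1)
      show "(derived G ^^ i) ?E \<noteq> {\<one>}" if "i < k" for i
        using less.prems(3)[of "Suc (Suc i)"] that n by (simp add: funpow_swap1)
    qed (use n in auto)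
    then have "81 ^ n \<le> 81 * (6561 * card ?E ^ 5)" using n by simp
    also have "\<dots> \<le> 81 * (6 * card ?E) ^ 5" by (simp add: power_mult_distrib)
    also have "\<dots> \<le> 81 * card H ^ 5"
      using card_second_derived[OF fin less.prems(1) neq] by (intro mult_le_mono2 power_mono) auto
    finally show ?thesis .
  qed
qed

section \<open>Covering by maximal cyclic subgroups\<close>

lemma exists_maximal_cyclic_subgroup_containing:
  assumes fin: "finite (carrier G)" and x: "x \<in> carrier G"
  obtains H where "maximal_cyclic_subgroup H G" "x \<in> H"
proof -
  let ?S = "{H. cyclic_subgroup H G \<and> x \<in> H}"
  have "finite ?S"
    by (rule finite_subset[of _ "Pow (carrier G)"])
       (use fin subgroup.subset in \<open>auto simp: cyclic_subgroup_def\<close>)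
  moreover have "generate G {x} \<in> ?S"
    using x cyclic_group_generated[of x] generate_is_subgroup[of "{x}"]
    by (auto simp: cyclic_subgroup_def subgroup_generated_def intro: generate.incl)
  ultimately have "\<exists>H\<in>?S. \<forall>K\<in>?S. H \<subseteq> K \<longrightarrow> H = K"
    by (intro finite_has_maximal) auto
  then obtain H where H: "H \<in> ?S" "\<forall>K\<in>?S. H \<subseteq> K \<longrightarrow> H = K" by (rule bexE)
  then have "maximal_cyclic_subgroup H G" "x \<in> H"
    by (auto simp: maximal_cyclic_subgroup_def)
  then show ?thesis by (rule that)
qed

text \<open>The maximal cyclic subgroups cover the group, so C can be taken as one of largest order
  among them.\<close>

lemma exists_large_cyclic_subgroup:
  assumes fin: "finite (carrier G)"
  obtains C where "cyclic_subgroup C G" "card (carrier G) \<le> num_maximal_cyclic G * card C"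
proof -
  let ?S = "{H. maximal_cyclic_subgroup H G}"
  have finS: "finite ?S"
    by (rule finite_subset[of _ "Pow (carrier G)"])
       (use fin subgroup.subset in \<open>auto simp: maximal_cyclic_subgroup_def cyclic_subgroup_def\<close>)
  have cover: "carrier G \<subseteq> \<Union>?S"
  proof
    fix x assume x: "x \<in> carrier G"
    obtain H where "maximal_cyclic_subgroup H G" "x \<in> H"
      using exists_maximal_cyclic_subgroup_containing[OF fin x] .
    then show "x \<in> \<Union>?S" by auto
  qed
  then have S0: "?S \<noteq> {}" using one_closed by fastforce
  define m where "m = Max (card ` ?S)"
  have "m \<in> card ` ?S" unfolding m_def using finS S0 by (intro Max_in) auto
  then obtain C where C: "maximal_cyclic_subgroup C G" "card C = m" by auto
  have "finite (\<Union>?S)"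
    by (rule finite_subset[OF _ fin])
       (use subgroup.subset in \<open>auto simp: maximal_cyclic_subgroup_def cyclic_subgroup_def\<close>)
  then have "card (carrier G) \<le> card (\<Union>?S)" using cover by (intro card_mono)
  also have "\<dots> \<le> (\<Sum>H\<in>?S. card H)" by (rule card_Union_le_sum_card)
  also have "\<dots> \<le> (\<Sum>H\<in>?S. m)" unfolding m_def using finS by (intro sum_mono Max_ge) auto
  also have "\<dots> = num_maximal_cyclic G * card C" using C by (simp add: num_maximal_cyclic_def)
  finally show ?thesis using C(1) by (intro that) (auto simp: maximal_cyclic_subgroup_def)
qed

section \<open>Derived length and quotients\<close>

text \<open>Solvability supplies the witness that gives the \<open>LEAST\<close> in
  \<open>derived_length\<close> its meaning.\<close>

lemma derived_series_derived_length:
  assumes "solvable G"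
  shows "(derived G ^^ derived_length G) (carrier G) = {\<one>}"
  using assms unfolding solvable_iff_trivial_derived_seq derived_length_def by (rule LeastI_ex)

lemma (in normal) group_hom_r_coset: "group_hom G (G Mod H) (\<lambda>x. H #> x)"
  using factorgroup_is_group r_coset_hom_Mod
  by (simp add: group_hom_def group_hom_axioms_def is_group)

lemma (in normal) r_coset_image_carrier: "(\<lambda>x. H #> x) ` carrier G = carrier (G Mod H)"
  by (auto simp: FactGroup_def RCOSETS_def)

lemma (in normal) solvable_FactGroup: "solvable G \<Longrightarrow> solvable (G Mod H)"
  using group_hom.surj_hom_imp_solvable[OF group_hom_r_coset r_coset_image_carrier] .

text \<open>Once the derived series of the quotient is trivial, the corresponding term in G lies in
  M, and one more step kills it because M is abelian.\<close>

lemma derived_length_le_Suc_factor: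
  assumes "solvable G" "M \<lhd> G" "comm_group (G\<lparr>carrier := M\<rparr>)"
  shows "derived_length G \<le> Suc (derived_length (G Mod M))"
proof -
  interpret M: normal M G by fact
  interpret h: group_hom G "G Mod M" "\<lambda>x. M #> x" by (rule M.group_hom_r_coset)
  let ?n = "derived_length (G Mod M)"
  let ?D = "(derived G ^^ ?n) (carrier G)"
  have img: "(\<lambda>x. M #> x) ` ?D = {M}"
    using h.exp_of_derived_img[of "carrier G" ?n] M.r_coset_image_carrier
      h.H.derived_series_derived_length[OF M.solvable_FactGroup[OF assms(1)]]
    by (simp add: FactGroup_def)
  have D: "?D \<subseteq> carrier G" by (rule exp_of_derived_in_carrier) simp
  have "?D \<subseteq> M"
  proof
    fix x assume x: "x \<in> ?D"
    then have "M #> x \<in> {M}" unfolding img[symmetric] by (rule imageI)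
    then have "M #> x = M" by (rule singletonD)
    then show "x \<in> M" using D x by (intro coset_join1[OF _ subsetD M.subgroup_axioms])
  qed
  then have "derived G ?D \<subseteq> derived G M" by (rule mono_derived)
  also have "derived G M = {\<one>}"
  proof -
    interpret MG: comm_group "G\<lparr>carrier := M\<rparr>" by fact
    show ?thesis
      using MG.derived_eq_singleton[of M] derived_consistent[OF _ M.subgroup_axioms] by simp
  qed
  finally have "(derived G ^^ Suc ?n) (carrier G) = {\<one>}"
    using subgroup.one_closed[OF derived_is_subgroup[OF D]] by auto
  then show "derived_length G \<le> Suc ?n"
    unfolding derived_length_def by (rule Least_le)
qed

end

section \<open>Combination of the estimates\<close>

theorem theorem1p1:
  fixes G :: "('a, 'b) monoid_scheme"
  assumes "group G" and "finite (carrier G)" and "solvable G"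
  shows "real (derived_length G) \<le> 2 + 5 / 2 * log 3 (real (num_maximal_cyclic G))"
proof -
  interpret group G by fact
  note fin = assms(2)
  let ?l = "num_maximal_cyclic G" and ?g = "card (carrier G)"
  obtain C where C: "cyclic_subgroup C G" "?g \<le> ?l * card C"
    using exists_large_cyclic_subgroup[OF fin] .
  have sC: "subgroup C G" using C by (simp add: cyclic_subgroup_def)
  then have "comm_group (G\<lparr>carrier := C\<rparr>)"
    using C(1) by (intro group.cyclic_imp_abelian_group subgroup_imp_group) (simp_all add: cyclic_subgroup_def)
  then obtain M where M: "M \<lhd> G" "comm_group (G\<lparr>carrier := M\<rparr>)" "card C ^ 2 \<le> card M * ?g"
    using exists_large_abelian_normal_subgroup[OF fin sC] by metis
  let ?Q = "G Mod M"
  interpret Q: group ?Q using M(1) by (rule normal.factorgroup_is_group)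
  let ?n = "derived_length ?Q" and ?q = "card (carrier ?Q)"
  have gpos: "?g > 0" using fin by (auto simp: card_gt_0_iff)
  have q: "?q * card M = ?g"
    using lagrange[OF normal_imp_subgroup[OF M(1)]] by (simp add: order_def FactGroup_def)
  then have pos: "?q > 0" "card M > 0" using gpos by (auto intro!: gr0I)
  have lpos: "?l > 0" using C(2) gpos by (auto intro!: gr0I)
  \<comment> \<open>Squaring brings in |C|^2 \<le> |M| |G|; cancelling |G| and then |M| bounds the
    index of M by the square of \<open>?l\<close>.\<close>
  have "?g ^ 2 \<le> (?l * card C) ^ 2" using C(2) by (intro power_mono) auto
  also have "\<dots> \<le> ?l ^ 2 * (card M * ?g)"
    using M(3) by (simp add: power_mult_distrib)
  finally have "?g \<le> ?l ^ 2 * card M" using gpos by (simp add: power2_eq_square)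
  then have "?q \<le> ?l ^ 2" using q pos by (metis mult_le_cancel2)
  have finQ: "finite (carrier ?Q)" using pos by (intro card_ge_0_finite)
  have "81 ^ ?n \<le> 81 * ?q ^ 5"
  proof (rule Q.card_ge_of_derived_series[OF finQ Q.subgroup_self])
    show "(derived ?Q ^^ k) (carrier ?Q) \<noteq> {\<one>\<^bsub>?Q\<^esub>}" if "k < ?n" for k
      using that unfolding derived_length_def by (rule not_less_Least)
  qed (use Q.derived_series_derived_length normal.solvable_FactGroup[OF M(1) assms(3)] in auto)
  also have "\<dots> \<le> 81 * (?l ^ 2) ^ 5"
    using \<open>?q \<le> ?l ^ 2\<close> by (intro mult_le_mono2 power_mono) auto
  finally have "81 ^ ?n \<le> 81 * ?l ^ 10" by (simp flip: power_mult)
  \<comment> \<open>Since 81 = 3^4, logarithms to base 3 give 4n \<le> 4 + 10 log \<open>?l\<close>.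
    Dividing by 4 yields the coefficient 5/2 and a constant 1; the abelian subgroup M contributes
    the other 1.\<close>
  then have "(3::nat) ^ (4 * ?n) \<le> 3 ^ 4 * ?l ^ 10" by (simp add: power_mult)
  then have "real (3 ^ (4 * ?n)) \<le> real (3 ^ 4 * ?l ^ 10)" by (simp only: of_nat_le_iff)
  then have "log 3 (real (3 ^ (4 * ?n))) \<le> log 3 (real (3 ^ 4 * ?l ^ 10))"
    using lpos by (intro log_mono) auto
  moreover have "log 3 (real (3 ^ (4 * ?n))) = 4 * real ?n"
    unfolding of_nat_power by (subst log_nat_power) auto
  moreover have "log 3 (real (3 ^ 4 * ?l ^ 10)) = 4 + 10 * log 3 (real ?l)"
    using lpos unfolding of_nat_mult of_nat_power
    by (subst log_mult) (auto simp only: log_nat_power, auto)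
  ultimately have "4 * real ?n \<le> 4 + 10 * log 3 (real ?l)" by simp
  moreover have "real (derived_length G) \<le> 1 + real ?n"
    using derived_length_le_Suc_factor[OF assms(3) M(1,2)] by simp
  ultimately show ?thesis by simp
qed

end
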